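(* Let $n>63$ be an integer. Then \[ m(1,J(n,3))=\begin{cases}4, & n \text{ even},\\ 6, & n \text{ odd and } n\equiv 0 \text{ or } 6 \pmod 9,\\ 7, & \text{otherwise}.\end{cases} \]
   Context: For integers $1\le k<n$, the Johnson graph $J(n,k)$ has as vertices the $k$-subsets of $\{1,\dots,n\}$, two subsets being adjacent when they meet in a $(k-1)$-subset. Its distinct eigenvalues are indexed in decreasing order $\theta_0>\theta_1>\dots>\theta_k$; in particular $\theta_1(J(n,k))=(k-1)(n-k-1)-1$ is the second largest eigenvalue. A vector is a $\theta$-eigenvector of a graph if it is nonzero and $Av=\theta v$ for the adjacency matrix $A$. A vector is nowhere-zero integer (NZI) if all its entries are nonzero integers, and $\|v\|_\infty=\max_x|v_x|$. For a graph $\Gamma$ and eigenvalue $\theta_i(\Gamma)$, $m(i,\Gamma)=\min\{\|u\|_\infty+1: u \text{ is an NZI } \theta_i(\Gamma)\text{-eigenvector of }\Gamma\}$. *)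

theory Defs
  imports Complex_Main "HOL-Number_Theory.Cong" "Graph_Theory.Pair_Digraph"
begin

(* An undirected graph is a digraph with a symmetric irreflexive arc relation.
   For 1 <= k, two k-subsets meeting in a (k-1)-subset are automatically distinct. *)
definition johnson_graph :: "nat \<Rightarrow> nat \<Rightarrow> nat set pair_pre_digraph" where
  "johnson_graph n k =
     \<lparr> pverts = {S. S \<subseteq> {1..n} \<and> card S = k},
       parcs = {(S, T). S \<subseteq> {1..n} \<and> card S = k \<and> T \<subseteq> {1..n} \<and> card T = k
                        \<and> card (S \<inter> T) = k - 1} \<rparr>"

lemma pair_graph_johnson_graph:
  assumes "1 \<le> k"
  shows "pair_graph (johnson_graph n k)"
proof -
  have fin: "finite (pverts (johnson_graph n k))"
    unfolding johnson_graph_def by simp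
  have sub: "parcs (johnson_graph n k) \<subseteq> pverts (johnson_graph n k) \<times> pverts (johnson_graph n k)"
    unfolding johnson_graph_def by auto
  have irr: "(S, S) \<notin> parcs (johnson_graph n k)" for S
    using assms unfolding johnson_graph_def by auto
  have symm: "sym (parcs (johnson_graph n k))"
    unfolding johnson_graph_def sym_def by (simp add: Int_commute)
  have finp: "finite (parcs (johnson_graph n k))"
    using finite_subset[OF sub] fin by simp
  show ?thesis
  proof unfold_locales
    fix e assume e: "e \<in> parcs (johnson_graph n k)"
    show "fst e \<in> pverts (johnson_graph n k)" using e sub by (cases e) auto
    show "snd e \<in> pverts (johnson_graph n k)" using e sub by (cases e) auto
    show "fst e \<noteq> snd e" using e irr by (metis prod.collapse)
  qed (use fin finp symm in \<open>simp_all add: symmetric_def\<close>)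
qed

definition adjacency_matrix :: "'v pair_pre_digraph \<Rightarrow> 'v \<Rightarrow> 'v \<Rightarrow> real" where
  "adjacency_matrix G x y = (if (x, y) \<in> parcs G then 1 else 0)"

(* Vectors are functions on the vertices; values off the vertex set are never inspected. *)
definition eigenvector_of :: "'v pair_pre_digraph \<Rightarrow> real \<Rightarrow> ('v \<Rightarrow> real) \<Rightarrow> bool" where
  "eigenvector_of G \<theta> v \<longleftrightarrow>
     (\<exists>x\<in>pverts G. v x \<noteq> 0) \<and>
     (\<forall>x\<in>pverts G. (\<Sum>y\<in>pverts G. adjacency_matrix G x y * v y) = \<theta> * v x)"

definition spectrum_of :: "'v pair_pre_digraph \<Rightarrow> real set" where
  "spectrum_of G = {\<theta>. \<exists>v. eigenvector_of G \<theta> v}"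

(* The distinct eigenvalues in decreasing order, indexed from 0. The spectrum of a finite
   graph is finite; the adjacency matrix is symmetric, so real eigenvalues suffice. *)
definition eigenvalue_nth :: "nat \<Rightarrow> 'v pair_pre_digraph \<Rightarrow> real" where
  "eigenvalue_nth i G = rev (sorted_list_of_set (spectrum_of G)) ! i"

definition nowhere_zero_integer :: "'v pair_pre_digraph \<Rightarrow> ('v \<Rightarrow> real) \<Rightarrow> bool" where
  "nowhere_zero_integer G v \<longleftrightarrow> (\<forall>x\<in>pverts G. v x \<in> \<int> \<and> v x \<noteq> 0)"

definition sup_norm :: "'v pair_pre_digraph \<Rightarrow> ('v \<Rightarrow> real) \<Rightarrow> real" where
  "sup_norm G v = Max ((\<lambda>x. \<bar>v x\<bar>) ` pverts G)"

(* The least element need not exist a priori: m_nzi i G is unspecified if there is no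
   nowhere-zero integer eigenvector. *)
definition m_nzi :: "nat \<Rightarrow> 'v pair_pre_digraph \<Rightarrow> real" where
  "m_nzi i G = (LEAST q. \<exists>u. nowhere_zero_integer G u \<and>
                             eigenvector_of G (eigenvalue_nth i G) u \<and> q = sup_norm G u + 1)"

end

theory Submission
  imports Defs
begin

text \<open>Summing the eigenvalue equation over the triples through a given pair, then over the pairs
  through a given point, shows that the eigenvectors for the second largest eigenvalue \<open>2 n - 9\<close> are
  exactly the nonzero functions \<open>S \<mapsto> (\<Sum>i\<in>S. f i)\<close> with \<open>\<Sum>i. f i = 0\<close>. If all entries are integers,
  then \<open>g = 3 f\<close> is integral and constant modulo 3. When the entries are nonzero and at most 5 in
  absolute value, a counting argument yields a negative and a positive value of \<open>g\<close>, each taken at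
  least three times. Testing triples with these repeated values leaves only the pairs
  \<open>{-5, 1}\<close>, \<open>{-3, 3}\<close> and \<open>{-5, 4}\<close> up to sign. In the first two cases every value of \<open>g\<close> is odd, so
  \<open>n\<close> is even; in the last one all values but at most one are congruent to 4 modulo 9, the
  exceptional one being congruent to 7, and \<open>\<Sum>i. g i = 0\<close> determines \<open>n\<close> modulo 9.\<close>

section \<open>The second largest eigenvalue of $J(n,3)$ and its eigenvectors\<close>

text \<open>A neighbour of \<open>{a, b, c}\<close> arises by keeping two of the points and
  replacing the third. Each of the three sums also runs over the point being replaced and thereby
  counts \<open>{a, b, c}\<close> itself, hence the correction by 3.\<close>

lemma johnson_adj_sum:
  fixes v :: "nat set \<Rightarrow> real"
  assumes "a \<in> {1..n}" "b \<in> {1..n}" "c \<in> {1..n}" "distinct [a, b, c]"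
  shows "(\<Sum>y\<in>pverts (johnson_graph n 3). adjacency_matrix (johnson_graph n 3) {a, b, c} y * v y) =
    (\<Sum>x\<in>{1..n} - {a, b}. v {a, b, x}) + (\<Sum>x\<in>{1..n} - {a, c}. v {a, c, x})
    + (\<Sum>x\<in>{1..n} - {b, c}. v {b, c, x}) - 3 * v {a, b, c}"
proof -
  define X where "X = {1..n} - {a, b, c}"
  have X: "finite X" "X \<subseteq> {1..n}" "a \<notin> X" "b \<notin> X" "c \<notin> X" by (auto simp: X_def)
  have abc: "a \<noteq> b" "a \<noteq> c" "b \<noteq> c" using assms(4) by auto
  let ?N = "{S. S \<subseteq> {1..n} \<and> card S = 3 \<and> card ({a, b, c} \<inter> S) = 2}"
  have "{a, b, c} \<subseteq> {1..n}" "card {a, b, c} = 3" using assms by auto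
  then have "(\<Sum>y\<in>pverts (johnson_graph n 3). adjacency_matrix (johnson_graph n 3) {a, b, c} y * v y)
      = (\<Sum>y\<in>pverts (johnson_graph n 3). if y \<in> ?N then v y else 0)"
    by (intro sum.cong) (auto simp: adjacency_matrix_def johnson_graph_def)
  also have "\<dots> = sum v (pverts (johnson_graph n 3) \<inter> ?N)"
    by (simp add: sum.inter_restrict johnson_graph_def)
  also have "pverts (johnson_graph n 3) \<inter> ?N = ?N"
    by (auto simp: johnson_graph_def)
  also have "?N = (\<lambda>x. {a, b, x}) ` X \<union> (\<lambda>x. {a, c, x}) ` X \<union> (\<lambda>x. {b, c, x}) ` X"
  proof (intro equalityI subsetI)
    fix S assume S: "S \<in> ?N"
    then have fin: "finite S" using finite_subset by blast
    have "card S = card ({a, b, c} \<inter> S) + card (S - {a, b, c})"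
      using card_Diff_subset_Int[of S "{a, b, c}"] fin card_mono[OF fin, of "{a, b, c} \<inter> S"]
      by (simp add: Int_commute)
    with S have "card (S - {a, b, c}) = 1" by auto
    then obtain x where x: "S - {a, b, c} = {x}" by (rule card_1_singletonE)
    then have "x \<in> S - {a, b, c}" by simp
    with S have "x \<in> X" by (simp add: X_def subset_iff)
    have S_eq: "S = ({a, b, c} \<inter> S) \<union> {x}"
      using Int_Diff_Un[of S "{a, b, c}"] unfolding x by (simp only: Int_commute)
    have "{a, b, c} \<inter> S \<in> {{a, b}, {a, c}, {b, c}}"
    proof -
      have "card ({a, b, c} - S) = 1"
        using S card_Diff_subset_Int[of "{a, b, c}" S] \<open>card {a, b, c} = 3\<close> by simp
      then obtain y where y: "{a, b, c} - S = {y}" by (rule card_1_singletonE)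
      then have Int_eq: "{a, b, c} \<inter> S = {a, b, c} - {y}" and "y \<in> {a, b, c}" by blast+
      then consider "y = a" | "y = b" | "y = c" by blast
      then show ?thesis unfolding Int_eq using abc by cases auto
    qed
    then have "S \<in> {{a, b} \<union> {x}, {a, c} \<union> {x}, {b, c} \<union> {x}}"
      using S_eq by (metis (no_types, lifting) insert_iff empty_iff)
    then have "S = {a, b, x} \<or> S = {a, c, x} \<or> S = {b, c, x}"
      by (simp add: insert_commute)
    with \<open>x \<in> X\<close> show "S \<in> (\<lambda>x. {a, b, x}) ` X \<union> (\<lambda>x. {a, c, x}) ` X \<union> (\<lambda>x. {b, c, x}) ` X"
      by blast
  next
    fix S assume "S \<in> (\<lambda>x. {a, b, x}) ` X \<union> (\<lambda>x. {a, c, x}) ` X \<union> (\<lambda>x. {b, c, x}) ` X"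
    then obtain x where "x \<in> X" "S = {a, b, x} \<or> S = {a, c, x} \<or> S = {b, c, x}" by blast
    moreover from this have "{a, b, c} \<inter> S \<in> {{a, b}, {a, c}, {b, c}}"
      using X abc by (elim disjE) auto
    ultimately show "S \<in> ?N" using assms X abc
      by (auto simp: card_insert_if)
  qed
  also have "sum v \<dots> = (\<Sum>x\<in>X. v {a, b, x}) + (\<Sum>x\<in>X. v {a, c, x}) + (\<Sum>x\<in>X. v {b, c, x})"
  proof -
    have "inj_on (\<lambda>x. {p, q, x}) X" if "p \<notin> X" "q \<notin> X" for p q
      using that by (intro inj_onI) (metis insertE insertI1 insert_commute singletonD)
    moreover have "(\<lambda>x. {a, b, x}) ` X \<inter> (\<lambda>x. {a, c, x}) ` X = {}"
      "((\<lambda>x. {a, b, x}) ` X \<union> (\<lambda>x. {a, c, x}) ` X) \<inter> (\<lambda>x. {b, c, x}) ` X = {}"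
      using X abc by (auto simp: set_eq_iff)
    ultimately show ?thesis using X by (simp add: sum.union_disjoint sum.reindex)
  qed
  also have "(\<Sum>x\<in>X. v {a, b, x}) = (\<Sum>x\<in>{1..n} - {a, b}. v {a, b, x}) - v {a, b, c}"
  proof -
    have "{1..n} - {a, b} = insert c X" using assms(3) abc by (auto simp: X_def)
    then show ?thesis using X by simp
  qed
  also have "(\<Sum>x\<in>X. v {a, c, x}) = (\<Sum>x\<in>{1..n} - {a, c}. v {a, c, x}) - v {a, b, c}"
  proof -
    have "{1..n} - {a, c} = insert b X" using assms(2) abc by (auto simp: X_def)
    then show ?thesis using X by (simp add: insert_commute)
  qed
  also have "(\<Sum>x\<in>X. v {b, c, x}) = (\<Sum>x\<in>{1..n} - {b, c}. v {b, c, x}) - v {a, b, c}"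
  proof -
    have "{1..n} - {b, c} = insert a X" using assms(1) abc by (auto simp: X_def)
    then show ?thesis using X by (simp add: insert_commute)
  qed
  finally show ?thesis by simp
qed

lemma johnson_pverts_iff:
  "S \<in> pverts (johnson_graph n 3) \<longleftrightarrow>
    (\<exists>a\<in>{1..n}. \<exists>b\<in>{1..n}. \<exists>c\<in>{1..n}. distinct [a, b, c] \<and> S = {a, b, c})"
proof
  assume "S \<in> pverts (johnson_graph n 3)"
  then have "S \<subseteq> {1..n}" "card S = 3" by (simp_all add: johnson_graph_def)
  moreover from this obtain a b c where "S = {a, b, c}" "distinct [a, b, c]"
    by (auto simp: card_3_iff)
  ultimately show "\<exists>a\<in>{1..n}. \<exists>b\<in>{1..n}. \<exists>c\<in>{1..n}. distinct [a, b, c] \<and> S = {a, b, c}"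
    by (metis insert_subset)
qed (auto simp: johnson_graph_def)

lemma sum_Diff_pair:
  fixes f :: "'a \<Rightarrow> 'b::ab_group_add"
  assumes "finite A" "a \<in> A" "b \<in> A" "a \<noteq> b"
  shows "sum f (A - {a, b}) = sum f A - f a - f b"
proof -
  have "sum f (A - {a, b}) = sum f (A - {a} - {b})" by (rule arg_cong[where f = "sum f"]) blast
  also have "\<dots> = sum f A - f a - f b" using assms by (simp add: sum_diff1)
  finally show ?thesis .
qed

text \<open>The value 0 on degenerate triples lets pair and point sums range over all of
  \<open>{1..n}\<close> without side conditions.\<close>

definition triple_val :: "(nat set \<Rightarrow> real) \<Rightarrow> nat \<Rightarrow> nat \<Rightarrow> nat \<Rightarrow> real" where
  "triple_val v a b c = (if distinct [a, b, c] then v {a, b, c} else 0)"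

definition pair_sum :: "nat \<Rightarrow> (nat set \<Rightarrow> real) \<Rightarrow> nat \<Rightarrow> nat \<Rightarrow> real" where
  "pair_sum n v a b = (\<Sum>x\<in>{1..n}. triple_val v a b x)"

definition point_sum :: "nat \<Rightarrow> (nat set \<Rightarrow> real) \<Rightarrow> nat \<Rightarrow> real" where
  "point_sum n v a = (\<Sum>b\<in>{1..n}. pair_sum n v a b)"

lemma triple_val_commute: "triple_val v a b c = triple_val v b a c"
  by (auto simp: triple_val_def insert_commute)

lemma pair_sum_commute: "pair_sum n v a b = pair_sum n v b a"
  unfolding pair_sum_def by (intro sum.cong refl triple_val_commute)

lemma pair_sum_same [simp]: "pair_sum n v a a = 0"
  by (simp add: pair_sum_def triple_val_def)

lemma pair_sum_eq:
  assumes "a \<noteq> b"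
  shows "pair_sum n v a b = (\<Sum>x\<in>{1..n} - {a, b}. v {a, b, x})"
  unfolding pair_sum_def
  by (rule sum.mono_neutral_cong_right) (use assms in \<open>auto simp: triple_val_def\<close>)

lemma johnson_eigenvector_pair_sum:
  assumes "eigenvector_of (johnson_graph n 3) \<theta> v"
    and "a \<in> {1..n}" "b \<in> {1..n}" "c \<in> {1..n}" "distinct [a, b, c]"
  shows "(\<theta> + 3) * v {a, b, c} = pair_sum n v a b + pair_sum n v a c + pair_sum n v b c"
proof -
  have "{a, b, c} \<in> pverts (johnson_graph n 3)" using assms(2-5) unfolding johnson_pverts_iff by blast
  with assms(1) have "\<theta> * v {a, b, c} =
      (\<Sum>y\<in>pverts (johnson_graph n 3). adjacency_matrix (johnson_graph n 3) {a, b, c} y * v y)"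
    by (simp add: eigenvector_of_def)
  with assms(5) show ?thesis
    unfolding johnson_adj_sum[OF assms(2-5)] by (simp add: pair_sum_eq algebra_simps)
qed

text \<open>Sum the previous identity over the third point x. The pair sum of a and b occurs n - 2
  times on the right, and each point sum must lose the term of the pair itself, so the coefficient
  is \<theta> + 3 - (n - 2) + 2.\<close>

lemma johnson_eigenvector_point_sum:
  assumes ev: "eigenvector_of (johnson_graph n 3) \<theta> v"
    and ab: "a \<in> {1..n}" "b \<in> {1..n}" "a \<noteq> b"
  shows "(\<theta> + 7 - real n) * pair_sum n v a b = point_sum n v a + point_sum n v b"
proof -
  have "card {a, b} \<le> card {1..n}" using ab by (intro card_mono) auto
  then have n: "n \<ge> 2" using ab by simp
  have "(\<theta> + 3) * pair_sum n v a b = (\<Sum>x\<in>{1..n} - {a, b}. (\<theta> + 3) * v {a, b, x})"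
    by (simp add: pair_sum_eq[OF ab(3)] sum_distrib_left)
  also have "\<dots> = (\<Sum>x\<in>{1..n} - {a, b}. pair_sum n v a b + pair_sum n v a x + pair_sum n v b x)"
    by (intro sum.cong refl johnson_eigenvector_pair_sum[OF ev]) (use ab in auto)
  also have "\<dots> = real (card ({1..n} - {a, b})) * pair_sum n v a b
      + (point_sum n v a - pair_sum n v a b) + (point_sum n v b - pair_sum n v b a)"
    using ab by (simp add: sum.distrib sum_Diff_pair point_sum_def)
  also have "card ({1..n} - {a, b}) = n - 2" using ab by (simp add: card_Diff_subset)
  finally show ?thesis using n by (simp add: pair_sum_commute[of n v b a] of_nat_diff algebra_simps)
qed

text \<open>The same summation one level up: sum the previous identity over all b different from
  a.\<close>

lemma johnson_eigenvector_total_sum: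
  assumes ev: "eigenvector_of (johnson_graph n 3) \<theta> v" and a: "a \<in> {1..n}"
  shows "(\<theta> + 9 - 2 * real n) * point_sum n v a = (\<Sum>i\<in>{1..n}. point_sum n v i)"
proof -
  have "(\<theta> + 7 - real n) * point_sum n v a = (\<Sum>b\<in>{1..n}. (\<theta> + 7 - real n) * pair_sum n v a b)"
    by (simp add: point_sum_def sum_distrib_left)
  also have "\<dots> = (\<Sum>b\<in>{1..n} - {a}. (\<theta> + 7 - real n) * pair_sum n v a b)"
    using a by (subst sum_diff1) auto
  also have "\<dots> = (\<Sum>b\<in>{1..n} - {a}. point_sum n v a + point_sum n v b)"
    by (intro sum.cong refl johnson_eigenvector_point_sum[OF ev]) (use a in auto)
  also have "\<dots> = real (n - 1) * point_sum n v a + ((\<Sum>i\<in>{1..n}. point_sum n v i) - point_sum n v a)"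
    using a by (simp add: sum.distrib sum_diff1)
  finally show ?thesis using a by (simp add: of_nat_diff algebra_simps)
qed

lemma johnson_eigenvector_total_sum_eigen:
  assumes ev: "eigenvector_of (johnson_graph n 3) \<theta> v"
  shows "(\<theta> + 9 - 3 * real n) * (\<Sum>i\<in>{1..n}. point_sum n v i) = 0"
proof -
  have "(\<theta> + 9 - 2 * real n) * (\<Sum>i\<in>{1..n}. point_sum n v i)
      = (\<Sum>a\<in>{1..n}. \<Sum>i\<in>{1..n}. point_sum n v i)"
    unfolding sum_distrib_left
    by (intro sum.cong refl) (metis johnson_eigenvector_total_sum[OF ev] sum_distrib_left)
  then show ?thesis by (simp add: algebra_simps)
qed

text \<open>For any other \<theta> all coefficients in the chain of summed identities are nonzero.
  Then the total, the point sums, the pair sums and finally the vector itself vanish in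
  turn.\<close>

lemma johnson_spectrum_subset:
  "spectrum_of (johnson_graph n 3) \<subseteq> {3 * real n - 9, 2 * real n - 9, real n - 7, -3}"
proof
  fix \<theta> assume "\<theta> \<in> spectrum_of (johnson_graph n 3)"
  then obtain v where ev: "eigenvector_of (johnson_graph n 3) \<theta> v"
    by (auto simp: spectrum_of_def)
  then obtain S where "S \<in> pverts (johnson_graph n 3)" "v S \<noteq> 0"
    by (auto simp: eigenvector_of_def)
  then obtain a b c where abc: "a \<in> {1..n}" "b \<in> {1..n}" "c \<in> {1..n}" "distinct [a, b, c]"
    and nz: "v {a, b, c} \<noteq> 0"
    unfolding johnson_pverts_iff by blast
  show "\<theta> \<in> {3 * real n - 9, 2 * real n - 9, real n - 7, -3}"
  proof (rule ccontr)
    assume \<theta>: "\<not> ?thesis"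
    have "(\<Sum>i\<in>{1..n}. point_sum n v i) = 0"
      using johnson_eigenvector_total_sum_eigen[OF ev] \<theta> by (simp only: mult_eq_0_iff) simp
    then have "point_sum n v i = 0" if "i \<in> {1..n}" for i
      using johnson_eigenvector_total_sum[OF ev that] \<theta> by auto
    then have "pair_sum n v i j = 0" if "i \<in> {1..n}" "j \<in> {1..n}" "i \<noteq> j" for i j
      using johnson_eigenvector_point_sum[OF ev that] that \<theta> by auto
    then have "(\<theta> + 3) * v {a, b, c} = 0"
      using johnson_eigenvector_pair_sum[OF ev abc] abc by simp
    with nz \<theta> show False by auto
  qed
qed

lemma johnson_eigenvector_const:
  assumes "n \<ge> 3"
  shows "eigenvector_of (johnson_graph n 3) (3 * real n - 9) (\<lambda>_. 1)"
  unfolding eigenvector_of_def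
proof (intro conjI ballI)
  have "{1, 2, 3} \<in> pverts (johnson_graph n 3)" using assms by (simp add: johnson_graph_def)
  then show "\<exists>x\<in>pverts (johnson_graph n 3). (1::real) \<noteq> 0" by auto
next
  fix S assume "S \<in> pverts (johnson_graph n 3)"
  then obtain a b c where abc: "a \<in> {1..n}" "b \<in> {1..n}" "c \<in> {1..n}" "distinct [a, b, c]"
    and S: "S = {a, b, c}"
    unfolding johnson_pverts_iff by blast
  show "(\<Sum>y\<in>pverts (johnson_graph n 3). adjacency_matrix (johnson_graph n 3) S y * 1)
      = (3 * real n - 9) * 1"
    unfolding S johnson_adj_sum[OF abc, of "\<lambda>_. 1"] using abc assms
    by (simp add: sum_Diff_pair del: sum_constant) simp
qed

text \<open>Since \<open>f\<close> sums to 0, the extensions of a pair {p, q} contribute (n - 3)(f p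
  + f q). Each point of a triple lies in two of its pairs, and the correction by 3 gives 2(n - 3) -
  3 = 2n - 9.\<close>

lemma johnson_eigenvector_sum:
  fixes f :: "nat \<Rightarrow> real"
  assumes f: "(\<Sum>i\<in>{1..n}. f i) = 0" and nz: "S \<in> pverts (johnson_graph n 3)" "(\<Sum>i\<in>S. f i) \<noteq> 0"
  shows "eigenvector_of (johnson_graph n 3) (2 * real n - 9) (\<lambda>S. \<Sum>i\<in>S. f i)"
  unfolding eigenvector_of_def
proof (intro conjI ballI)
  show "\<exists>x\<in>pverts (johnson_graph n 3). (\<Sum>i\<in>x. f i) \<noteq> 0" using nz by blast
next
  fix S assume "S \<in> pverts (johnson_graph n 3)"
  then obtain a b c where abc: "a \<in> {1..n}" "b \<in> {1..n}" "c \<in> {1..n}" "distinct [a, b, c]"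
    and S: "S = {a, b, c}"
    unfolding johnson_pverts_iff by blast
  have ext: "(\<Sum>x\<in>{1..n} - {p, q}. \<Sum>i\<in>{p, q, x}. f i) = (real n - 3) * (f p + f q)"
    if "p \<in> {1..n}" "q \<in> {1..n}" "p \<noteq> q" for p q
  proof -
    have "(\<Sum>x\<in>{1..n} - {p, q}. \<Sum>i\<in>{p, q, x}. f i) = (\<Sum>x\<in>{1..n} - {p, q}. f p + f q + f x)"
      using that by (intro sum.cong) auto
    also have "\<dots> = (\<Sum>x\<in>{1..n}. f p + f q + f x) - (f p + f q + f p) - (f p + f q + f q)"
      using that by (intro sum_Diff_pair) auto
    also have "(\<Sum>x\<in>{1..n}. f p + f q + f x) = real n * (f p + f q)"
      using f by (simp add: sum.distrib algebra_simps)
    finally show ?thesis by (simp add: algebra_simps)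
  qed
  have ne: "a \<noteq> b" "a \<noteq> c" "b \<noteq> c" using abc by auto
  then have "(\<Sum>i\<in>{a, b, c}. f i) = f a + f b + f c" by simp
  then show "(\<Sum>y\<in>pverts (johnson_graph n 3). adjacency_matrix (johnson_graph n 3) S y * (\<Sum>i\<in>y. f i))
      = (2 * real n - 9) * (\<Sum>i\<in>S. f i)"
    unfolding S johnson_adj_sum[OF abc, of "\<lambda>S. \<Sum>i\<in>S. f i"]
      ext[OF abc(1,2) ne(1)] ext[OF abc(1,3) ne(2)] ext[OF abc(2,3) ne(3)]
    by (simp add: algebra_simps)
qed

text \<open>For \<theta> = 2n - 9 the factors of the total, of a pair sum and of an entry are -n, n
  - 2 and 2(n - 3). So the total is 0, and entries can be recovered from point sums. The 2 cancels
  because each point lies in two pairs of a triple.\<close>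

lemma johnson_eigenvector_imp_sum:
  assumes ev: "eigenvector_of (johnson_graph n 3) (2 * real n - 9) v" and n: "n \<ge> 4"
  obtains f where "(\<Sum>i\<in>{1..n}. f i) = 0"
    and "\<And>a b c. \<lbrakk>a \<in> {1..n}; b \<in> {1..n}; c \<in> {1..n}; distinct [a, b, c]\<rbrakk> \<Longrightarrow> v {a, b, c} = f a + f b + f c"
proof
  let ?k = "(real n - 3) * (real n - 2)"
  show "(\<Sum>i\<in>{1..n}. point_sum n v i / ?k) = 0"
    using johnson_eigenvector_total_sum_eigen[OF ev] n by (simp flip: sum_divide_distrib)
  fix a b c assume abc: "a \<in> {1..n}" "b \<in> {1..n}" "c \<in> {1..n}" "distinct [a, b, c]"
  have pair: "pair_sum n v i j = (point_sum n v i + point_sum n v j) / (real n - 2)"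
    if "i \<in> {1..n}" "j \<in> {1..n}" "i \<noteq> j" for i j
    using johnson_eigenvector_point_sum[OF ev that] n by (simp add: field_simps)
  have "2 * ((real n - 3) * v {a, b, c}) =
      2 * ((point_sum n v a + point_sum n v b + point_sum n v c) / (real n - 2))"
    using johnson_eigenvector_pair_sum[OF ev abc] abc by (simp add: pair add_divide_distrib algebra_simps)
  then have "(real n - 3) * v {a, b, c} =
      (point_sum n v a + point_sum n v b + point_sum n v c) / (real n - 2)" by linarith
  then have "v {a, b, c} = (point_sum n v a + point_sum n v b + point_sum n v c) / (real n - 2) / (real n - 3)"
    using n by (simp add: eq_divide_eq mult_ac)
  then show "v {a, b, c} = point_sum n v a / ?k + point_sum n v b / ?k + point_sum n v c / ?k"
    by (simp add: add_divide_distrib mult.commute)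
qed

lemma eigenvalue_nth_1_johnson:
  assumes n: "n \<ge> 4"
  shows "eigenvalue_nth 1 (johnson_graph n 3) = 2 * real n - 9"
proof -
  let ?\<sigma> = "spectrum_of (johnson_graph n 3)"
  have "3 * real n - 9 \<in> ?\<sigma>"
    using johnson_eigenvector_const[of n] n unfolding spectrum_of_def by auto
  moreover have "2 * real n - 9 \<in> ?\<sigma>"
  proof -
    \<comment> \<open>Any weight with sum 0 that does not cancel on some triple gives an
      eigenvector; here the triple {1, 3, 4} has sum 1.\<close>
    define f :: "nat \<Rightarrow> real" where "f = (\<lambda>i. of_bool (i = 1) - of_bool (i = 2))"
    have "(\<Sum>i\<in>{1..n}. f i) = 0" using n by (simp add: f_def sum_subtractf of_bool_def)
    moreover have "{1, 3, 4} \<in> pverts (johnson_graph n 3)" using n by (simp add: johnson_graph_def)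
    moreover have "(\<Sum>i\<in>{1, 3, 4}. f i) \<noteq> 0" by (simp add: f_def)
    ultimately show ?thesis unfolding spectrum_of_def using johnson_eigenvector_sum by blast
  qed
  \<comment> \<open>Whether the two remaining candidates are eigenvalues is left open: for n at
    least 4 both lie below 2n - 9, so they cannot affect index 1.\<close>
  moreover define R where "R = ?\<sigma> \<inter> {real n - 7, -3}"
  ultimately have \<sigma>: "?\<sigma> = R \<union> {2 * real n - 9, 3 * real n - 9}"
    using johnson_spectrum_subset[of n] by blast
  define xs where "xs = sorted_list_of_set R @ [2 * real n - 9, 3 * real n - 9]"
  have "finite R" by (simp add: R_def)
  moreover have "\<forall>x\<in>R. x < 2 * real n - 9" using n by (auto simp: R_def)
  ultimately have "sorted xs" "distinct xs" "set xs = ?\<sigma>"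
    using n unfolding xs_def \<sigma> by (auto simp: sorted_append less_imp_le intro: order_trans) 
  then have "sorted_list_of_set ?\<sigma> = xs"
    by (metis sorted_list_of_set.idem_if_sorted_distinct)
  then show ?thesis by (simp add: eigenvalue_nth_def xs_def)
qed

section \<open>Labellings of the points\<close>

text \<open>Labels are scaled by 3 to stay integral: a vertex \<open>S\<close> gets the entry
  \<open>(\<Sum>i\<in>S. g i) / 3\<close> of the eigenvector, so \<open>N\<close> bounds its sup norm.\<close>

definition admissible_labelling :: "nat \<Rightarrow> nat \<Rightarrow> (nat \<Rightarrow> int) \<Rightarrow> bool" where
  "admissible_labelling n N g \<longleftrightarrow>
     (\<Sum>i\<in>{1..n}. g i) = 0 \<and>
     (\<forall>i\<in>{1..n}. \<forall>j\<in>{1..n}. 3 dvd g i - g j) \<and>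
     (\<forall>a\<in>{1..n}. \<forall>b\<in>{1..n}. \<forall>c\<in>{1..n}. distinct [a, b, c] \<longrightarrow>
        g a + g b + g c \<noteq> 0 \<and> \<bar>g a + g b + g c\<bar> \<le> 3 * int N)"

lemma admissible_labellingD:
  assumes "admissible_labelling n N g"
  shows "(\<Sum>i\<in>{1..n}. g i) = 0"
    and "\<And>i j. i \<in> {1..n} \<Longrightarrow> j \<in> {1..n} \<Longrightarrow> 3 dvd g i - g j"
    and "\<And>a b c. \<lbrakk>a \<in> {1..n}; b \<in> {1..n}; c \<in> {1..n}; distinct [a, b, c]\<rbrakk>
           \<Longrightarrow> g a + g b + g c \<noteq> 0 \<and> \<bar>g a + g b + g c\<bar> \<le> 3 * int N"
  using assms unfolding admissible_labelling_def by blast+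

text \<open>This symmetry halves the later case distinctions on signs.\<close>

lemma admissible_labelling_uminus:
  assumes "admissible_labelling n N g"
  shows "admissible_labelling n N (\<lambda>i. - g i)"
  unfolding admissible_labelling_def
proof (intro conjI ballI impI)
  show "(\<Sum>i\<in>{1..n}. - g i) = 0"
    using admissible_labellingD(1)[OF assms] by (simp add: sum_negf)
next
  fix i j assume "i \<in> {1..n}" "j \<in> {1..n}"
  then show "3 dvd - g i - - g j"
    using admissible_labellingD(2)[OF assms, of j i] by simp
next
  fix a b c assume "a \<in> {1..n}" "b \<in> {1..n}" "c \<in> {1..n}" "distinct [a, b, c]"
  note * = admissible_labellingD(3)[OF assms this]
  show "- g a + - g b + - g c \<noteq> 0" "\<bar>- g a + - g b + - g c\<bar> \<le> 3 * int N"
    using * by linarith+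
qed

lemma admissible_labelling_mono:
  assumes "admissible_labelling n N g" "N \<le> M"
  shows "admissible_labelling n M g"
  unfolding admissible_labelling_def
proof (intro conjI ballI impI)
  fix a b c assume "a \<in> {1..n}" "b \<in> {1..n}" "c \<in> {1..n}" "distinct [a, b, c]"
  note * = admissible_labellingD(3)[OF assms(1) this]
  show "g a + g b + g c \<noteq> 0" "\<bar>g a + g b + g c\<bar> \<le> 3 * int M"
    using * assms(2) by linarith+
qed (use admissible_labellingD(1,2)[OF assms(1)] in simp_all)

section \<open>Labels taken at least three times\<close>

lemma card_ge_3_avoid2:
  assumes "card A \<ge> 3" obtains k where "k \<in> A" "k \<noteq> i" "k \<noteq> j"
proof -
  have "\<not> A \<subseteq> {i, j}"
  proof
    assume "A \<subseteq> {i, j}"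
    then have "card A \<le> card {i, j}" by (intro card_mono) auto
    also have "\<dots> \<le> 2" by (simp add: card_insert_if)
    finally show False using assms by simp
  qed
  then show ?thesis using that by blast
qed

lemma sum_le_fibres:
  fixes g :: "'a \<Rightarrow> int" and h :: "int \<Rightarrow> int"
  assumes "finite A" "finite V" "g ` A \<subseteq> V"
    and "\<And>v. v \<in> V \<Longrightarrow> card {i \<in> A. g i = v} \<le> m" "\<And>v. v \<in> V \<Longrightarrow> h v \<ge> 0"
  shows "(\<Sum>i\<in>A. h (g i)) \<le> int m * (\<Sum>v\<in>V. h v)"
proof -
  have "(\<Sum>i\<in>A. h (g i)) = (\<Sum>v\<in>V. \<Sum>i\<in>{i \<in> A. g i = v}. h (g i))"
    using sum.group[OF assms(1-3), of "\<lambda>i. h (g i)"] by simp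
  also have "\<dots> = (\<Sum>v\<in>V. int (card {i \<in> A. g i = v}) * h v)"
    by (intro sum.cong) auto
  also have "\<dots> \<le> (\<Sum>v\<in>V. int m * h v)"
    using assms by (intro sum_mono mult_right_mono) auto
  finally show ?thesis by (simp add: sum_distrib_left)
qed

lemma card_ge_3_obtain:
  assumes "\<not> card A \<le> 2"
  obtains a b c where "a \<in> A" "b \<in> A" "c \<in> A" "distinct [a, b, c]"
proof -
  from assms have "3 \<le> card A" by simp
  then obtain B where "B \<subseteq> A" "card B = 3" by (rule obtain_subset_with_card_n)
  then obtain a b c where "B = {a, b, c}" "distinct [a, b, c]" by (auto simp: card_3_iff)
  with \<open>B \<subseteq> A\<close> show ?thesis by (intro that[of a b c]) auto
qed

text \<open>Since the labels sum to 0, n is the sum of all 1 - g i, to which positive labels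
  contribute nothing positive. If every negative label occurred at most twice, the labels that are
  at most 0 would contribute at most 27 + 18 = 45.\<close>

lemma admissible_frequent_negative:
  assumes g: "admissible_labelling n 5 g" and n: "n > 63"
  shows "\<exists>v<0. card {i \<in> {1..n}. g i = v} \<ge> 3"
proof (rule ccontr)
  assume *: "\<not> ?thesis"
  note sum0 = admissible_labellingD(1)[OF g]
    and cong = admissible_labellingD(2)[OF g]
    and triple = admissible_labellingD(3)[OF g]
  \<comment> \<open>The label 0 is also rare: three occurrences would give a triple with sum
    0.\<close>
  have fibre: "card {i \<in> {1..n}. g i = v} \<le> 2" if "v \<le> 0" for v
  proof (cases "v = 0")
    case True
    show ?thesis
    proof (rule ccontr)
      assume "\<not> ?thesis"
      then obtain a b c where "a \<in> {i \<in> {1..n}. g i = v}" "b \<in> {i \<in> {1..n}. g i = v}"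
          "c \<in> {i \<in> {1..n}. g i = v}" "distinct [a, b, c]"
        by (rule card_ge_3_obtain)
      with True triple[of a b c] show False by auto
    qed
  next
    case False
    with that have "v < 0" by simp
    with * have "\<not> 3 \<le> card {i \<in> {1..n}. g i = v}" by blast
    then show ?thesis by linarith
  qed
  \<comment> \<open>The threshold 6 is chosen because three labels of absolute value at least 6 and
    equal sign exceed the bound 15 on triple sums.\<close>
  define E where "E = {i \<in> {1..n}. g i \<le> -6}"
  define U where "U = {i \<in> {1..n}. g i \<ge> 6}"
  define M where "M = {i \<in> {1..n}. -5 \<le> g i \<and> g i \<le> 0}"
  have card_E: "card E \<le> 2"
  proof (rule ccontr)
    assume "\<not> ?thesis"
    then obtain a b c where "a \<in> E" "b \<in> E" "c \<in> E" "distinct [a, b, c]"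
      by (rule card_ge_3_obtain)
    with triple[of a b c] show False by (simp add: E_def)
  qed
  have card_U: "card U \<le> 2"
  proof (rule ccontr)
    assume "\<not> ?thesis"
    then obtain a b c where "a \<in> U" "b \<in> U" "c \<in> U" "distinct [a, b, c]"
      by (rule card_ge_3_obtain)
    with triple[of a b c] show False by (simp add: U_def)
  qed
  \<comment> \<open>This supplies companions with label at most 5, against which very negative
    labels are tested.\<close>
  have low: "card ({1..n} - U - {i}) \<ge> 3" for i
  proof -
    have "card ({1..n} - U - {i}) \<ge> card ({1..n} - U) - 1"
      by (simp add: card_Diff_singleton_if)
    moreover have "card ({1..n} - U) = n - card U"
      by (subst card_Diff_subset) (auto simp: U_def)
    ultimately show ?thesis using card_U n by linarith
  qed
  \<comment> \<open>A single label in \<open>E\<close>, tested with two labels at most 5, is at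
    least -25. Two labels in \<open>E\<close>, tested with one such label, sum to at least -20. The
    contributions are at most 26 and 22.\<close>
  have sum_E: "(\<Sum>i\<in>E. 1 - g i) \<le> 27"
  proof -
    have "finite E" by (simp add: E_def)
    consider "E = {}" | i where "E = {i}" | i j where "E = {i, j}" "i \<noteq> j"
      using card_E \<open>finite E\<close>
      by (auto simp: le_Suc_eq numeral_2_eq_2 card_Suc_eq)
    then show ?thesis
    proof cases
      case (2 i)
      obtain j where j: "j \<in> {1..n} - U - {i}" using card_ge_3_avoid2[OF low[of i]] by metis
      obtain k where k: "k \<in> {1..n} - U - {i}" "k \<noteq> j" using card_ge_3_avoid2[OF low[of i], of j] by metis
      have "i \<in> {1..n}" using 2 by (auto simp: E_def)
      with j k triple[of i j k] have "g i \<ge> -25" by (auto simp: U_def)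
      with 2 show ?thesis by simp
    next
      case (3 i j)
      obtain k where k: "k \<in> {1..n} - U - {i}" "k \<noteq> j" using card_ge_3_avoid2[OF low[of i], of j] by metis
      have "i \<in> {1..n}" "j \<in> {1..n}" using 3 by (auto simp: E_def)
      with k 3 triple[of i j k] have "g i + g j \<ge> -20" by (auto simp: U_def)
      with 3 show ?thesis by simp
    qed simp
  qed
  have "1 \<in> {1..n}" using n by simp
  \<comment> \<open>Only one residue class modulo 3 occurs, so there are two possible values in the
    range, each taken at most twice. The worst case is {-5, -2}, contributing 2(6 + 3) = 18.\<close>
  have sum_M: "(\<Sum>i\<in>M. 1 - g i) \<le> 18"
  proof -
    define V where "V = {v. -5 \<le> v \<and> v \<le> 0 \<and> v mod 3 = g 1 mod 3}"
    have V_eq: "V = {v \<in> {-5, -4, -3, -2, -1, 0}. v mod 3 = g 1 mod 3}"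
      unfolding V_def by (rule Collect_cong) auto
    have filter_insert: "{v \<in> insert x A. P v} = (if P x then insert x {v \<in> A. P v} else {v \<in> A. P v})"
      for x :: int and A P by auto
    have "g 1 mod 3 = 0 \<or> g 1 mod 3 = 1 \<or> g 1 mod 3 = 2"
      by presburger
    then have V: "V = {-3, 0} \<or> V = {-5, -2} \<or> V = {-4, -1}"
      unfolding V_eq filter_insert by (elim disjE) simp_all
    have "g ` M \<subseteq> V"
      using cong[OF _ \<open>1 \<in> {1..n}\<close>] by (auto simp: M_def V_def mod_eq_dvd_iff)
    moreover have "card {i \<in> M. g i = v} \<le> 2" if "v \<in> V" for v
    proof -
      have "card {i \<in> M. g i = v} \<le> card {i \<in> {1..n}. g i = v}"
        by (intro card_mono) (auto simp: M_def)
      with fibre[of v] that show ?thesis by (auto simp: V_def)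
    qed
    moreover have "finite M" by (simp add: M_def)
    moreover have "finite V" using V by auto
    moreover have "0 \<le> 1 - v" if "v \<in> V" for v using that by (simp add: V_def)
    ultimately have "(\<Sum>i\<in>M. 1 - g i) \<le> int 2 * (\<Sum>v\<in>V. 1 - v)"
      by (intro sum_le_fibres) auto
    also have "\<dots> \<le> 18" using V by auto
    finally show ?thesis .
  qed
  have "int n = (\<Sum>i\<in>{1..n}. 1 - g i)"
    using sum0 by (simp add: sum_subtractf)
  also have "\<dots> \<le> (\<Sum>i\<in>E \<union> M. 1 - g i)"
  proof -
    have "(\<Sum>i\<in>{1..n}. 1 - g i) = (\<Sum>i\<in>E \<union> M. 1 - g i) + (\<Sum>i\<in>{1..n} - (E \<union> M). 1 - g i)"
      by (subst sum.subset_diff[of "E \<union> M"]) (auto simp: E_def M_def)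
    moreover have "(\<Sum>i\<in>{1..n} - (E \<union> M). 1 - g i) \<le> 0"
      by (intro sum_nonpos) (auto simp: E_def M_def)
    ultimately show ?thesis by linarith
  qed
  also have "\<dots> = (\<Sum>i\<in>E. 1 - g i) + (\<Sum>i\<in>M. 1 - g i)"
    by (intro sum.union_disjoint) (auto simp: E_def M_def)
  finally show False using sum_E sum_M n by linarith
qed

lemma admissible_frequent_positive:
  assumes g: "admissible_labelling n 5 g" and n: "n > 63"
  shows "\<exists>v>0. card {i \<in> {1..n}. g i = v} \<ge> 3"
proof -
  obtain v where "v < 0" "card {i \<in> {1..n}. - g i = v} \<ge> 3"
    using admissible_frequent_negative[OF admissible_labelling_uminus[OF g] n] by blast
  moreover have "{i \<in> {1..n}. - g i = v} = {i \<in> {1..n}. g i = - v}" by auto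
  ultimately show ?thesis by (intro exI[of _ "-v"]) simp
qed

text \<open>With three occurrences, such a label can be found outside any two given points. It may
  therefore be inserted freely, even repeatedly, into the conditions on triples.\<close>

abbreviation frequent :: "nat \<Rightarrow> (nat \<Rightarrow> int) \<Rightarrow> int \<Rightarrow> bool" where
  "frequent n g v \<equiv> card {i \<in> {1..n}. g i = v} \<ge> 3"

lemma admissible_frequent_pair:
  assumes g: "admissible_labelling n N g" and v: "frequent n g v"
    and ij: "i \<in> {1..n}" "j \<in> {1..n}" "i \<noteq> j"
  shows "g i + g j + v \<noteq> 0 \<and> \<bar>g i + g j + v\<bar> \<le> 3 * int N"
proof -
  obtain k where k: "k \<in> {i \<in> {1..n}. g i = v}" "k \<noteq> i" "k \<noteq> j"
    using card_ge_3_avoid2[OF v] by metis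
  with admissible_labellingD(3)[OF g ij(1,2), of k] ij(3) show ?thesis by simp
qed

lemma admissible_frequent_single:
  assumes g: "admissible_labelling n N g" and v: "frequent n g v" and w: "frequent n g w"
    and i: "i \<in> {1..n}"
  shows "g i + v + w \<noteq> 0 \<and> \<bar>g i + v + w\<bar> \<le> 3 * int N"
proof -
  obtain j where "j \<in> {i \<in> {1..n}. g i = v}" "j \<noteq> i"
    using card_ge_3_avoid2[OF v] by metis
  with admissible_frequent_pair[OF g w i, of j] show ?thesis by auto
qed

lemma admissible_frequent_triple:
  assumes g: "admissible_labelling n N g" and "frequent n g u" "frequent n g v" "frequent n g w"
  shows "u + v + w \<noteq> 0 \<and> \<bar>u + v + w\<bar> \<le> 3 * int N" "3 dvd u - v"
proof -
  obtain i where i: "i \<in> {i \<in> {1..n}. g i = u}"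
    using card_ge_3_avoid2[OF assms(2)] by metis
  obtain j where j: "j \<in> {i \<in> {1..n}. g i = v}"
    using card_ge_3_avoid2[OF assms(3)] by metis
  show "u + v + w \<noteq> 0 \<and> \<bar>u + v + w\<bar> \<le> 3 * int N"
    using admissible_frequent_single[OF g assms(3,4), of i] i by auto
  show "3 dvd u - v" using admissible_labellingD(2)[OF g, of i j] i j by auto
qed

section \<open>Lower bounds: frequent labels and the residue of n\<close>

lemma even_if_sum_odds_eq_0:
  fixes g :: "nat \<Rightarrow> int"
  assumes "(\<Sum>i\<in>{1..n}. g i) = 0" "\<And>i. i \<in> {1..n} \<Longrightarrow> odd (g i)"
  shows "even n"
proof -
  have "{i \<in> {1..n}. odd (g i)} = {1..n}" using assms(2) by auto
  then show ?thesis using even_sum_iff[of "{1..n}" g] assms(1) by simp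
qed

text \<open>A negative and a positive frequent label v and w lie between -5 and 5, are congruent
  modulo 3, and satisfy neither 2v + w = 0 nor v + 2w = 0. Five pairs survive, three of which force
  \<open>n\<close> to be even.\<close>

lemma admissible_odd_frequent_pairs:
  assumes g: "admissible_labelling n 5 g" and n: "n > 63" and odd: "odd n"
  shows "frequent n g 4 \<and> frequent n g (-5) \<or> frequent n g (-4) \<and> frequent n g 5"
proof -
  obtain v where v: "v < 0" "frequent n g v"
    using admissible_frequent_negative[OF g n] by blast
  obtain w where w: "w > 0" "frequent n g w"
    using admissible_frequent_positive[OF g n] by blast
  have bounds: "-5 \<le> v" "w \<le> 5"
    using admissible_frequent_triple(1)[OF g v(2) v(2) v(2)]
      admissible_frequent_triple(1)[OF g w(2) w(2) w(2)] by auto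
  have nz: "2 * v + w \<noteq> 0" "v + 2 * w \<noteq> 0"
    using admissible_frequent_triple(1)[OF g v(2) v(2) w(2)]
      admissible_frequent_triple(1)[OF g v(2) w(2) w(2)] by auto
  have dvd: "3 dvd w - v" using admissible_frequent_triple(2)[OF g w(2) v(2) v(2)] .
  have single: "3 dvd g i - v" "g i + 2 * v \<noteq> 0" "g i + 2 * w \<noteq> 0" "g i + v + w \<noteq> 0"
    "\<bar>g i + 2 * v\<bar> \<le> 15" "\<bar>g i + 2 * w\<bar> \<le> 15" if "i \<in> {1..n}" for i
  proof -
    obtain j where j: "j \<in> {i \<in> {1..n}. g i = v}"
      using card_ge_3_avoid2[OF v(2)] by metis
    with admissible_labellingD(2)[OF g that, of j] show "3 dvd g i - v" by simp
  qed (use admissible_frequent_single[OF g v(2) v(2) that] admissible_frequent_single[OF g w(2) w(2) that]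
      admissible_frequent_single[OF g v(2) w(2) that] in auto)
  have "v \<in> {-5, -4, -3, -2, -1}" "w \<in> {1, 2, 3, 4, 5}" using bounds v w by auto
  then have "(v, w) \<in> {(-5, 1), (-1, 5), (-3, 3), (-5, 4), (-4, 5)}"
    using nz dvd by auto
  moreover have False if "(v, w) \<in> {(-5, 1), (-1, 5), (-3, 3)}"
  proof -
    note vw = that
    \<comment> \<open>In the range left by the bounds, the even members of the residue class are
      exactly the forbidden -2v, -2w and -v - w. For (-5, 1) the labels -5, 1, 7, 13 remain; for
      (-3, 3) the labels -9, -3, 3, 9; the case (-1, 5) mirrors the first.\<close>
    have "odd (g i)" if i: "i \<in> {1..n}" for i
      using vw single[OF i] by (elim insertE; clarsimp) presburger+
    with even_if_sum_odds_eq_0[OF admissible_labellingD(1)[OF g]] odd show False by blast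
  qed
  ultimately show ?thesis using v w by auto
qed

lemma admissible_frequent_4_5_mod_9:
  assumes g: "admissible_labelling n 5 g" and freq: "frequent n g 4" "frequent n g (-5)"
  shows "n mod 9 = 0 \<or> n mod 9 = 6"
proof -
  \<comment> \<open>The frequent labels 4 and -5 bound every label by 7 and -5 and exclude 1, since
    1 + 4 - 5 = 0.\<close>
  have vals: "g i \<in> {-5, -2, 4, 7}" if i: "i \<in> {1..n}" for i
  proof -
    obtain j where j: "j \<in> {i \<in> {1..n}. g i = 4}"
      using card_ge_3_avoid2[OF freq(1)] by metis
    have "3 dvd g i - 4" using admissible_labellingD(2)[OF g i, of j] j by simp
    moreover have "g i \<noteq> 1" "g i \<le> 7" "g i \<ge> -5"
      using admissible_frequent_single[OF g freq i] admissible_frequent_single[OF g freq(1) freq(1) i]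
        admissible_frequent_single[OF g freq(2) freq(2) i] by auto
    ultimately show ?thesis by simp presburger
  qed
  \<comment> \<open>Two exceptional labels always clash with a frequent one: -2 - 2 + 4 = 0, 7 - 2 -
    5 = 0, and 7 + 7 + 4 exceeds 15.\<close>
  have unique: "i = j" if "i \<in> {1..n}" "j \<in> {1..n}" "g i \<in> {-2, 7}" "g j \<in> {-2, 7}" for i j
  proof (rule ccontr)
    assume "i \<noteq> j"
    with admissible_frequent_pair[OF g freq(1) that(1,2)] admissible_frequent_pair[OF g freq(2) that(1,2)] that(3,4)
    show False by auto
  qed
  have sum0: "(\<Sum>i\<in>{1..n}. g i) = 0" using admissible_labellingD(1)[OF g] .
  show ?thesis
  proof (cases "\<exists>k\<in>{1..n}. g k \<in> {-2, 7}")
    case False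
    \<comment> \<open>Both 4 and -5 are 4 modulo 9, so 4n is divisible by 9.\<close>
    then have "9 dvd g i - 4" if "i \<in> {1..n}" for i using vals[OF that] that by auto
    then have "9 dvd (\<Sum>i\<in>{1..n}. g i - 4)" by (rule dvd_sum)
    also have "(\<Sum>i\<in>{1..n}. g i - 4) = - 4 * int n" using sum0 by (simp add: sum_subtractf)
    finally show ?thesis by presburger
  next
    case True
    then obtain k where k: "k \<in> {1..n}" "g k \<in> {-2, 7}" by blast
    have "9 dvd g i - 4" if "i \<in> {1..n} - {k}" for i
      using vals[of i] unique[OF k(1), of i] k(2) that by auto
    then have "9 dvd (\<Sum>i\<in>{1..n} - {k}. g i - 4)" by (rule dvd_sum)
    also have "(\<Sum>i\<in>{1..n} - {k}. g i - 4) = - 4 * int n - (g k - 4)"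
      using sum0 k by (subst sum_diff1) (auto simp: sum_subtractf)
    finally have "9 dvd - 4 * int n - (g k - 4)" .
    \<comment> \<open>Both -2 and 7 are 7 modulo 9, so 4n + 3 is divisible by 9, which means that n
      is 6 modulo 9.\<close>
    with k(2) show ?thesis by (elim insertE emptyE; simp only:) presburger+
  qed
qed

lemma admissible_odd_mod_9:
  assumes g: "admissible_labelling n 5 g" and n: "n > 63" and odd: "odd n"
  shows "n mod 9 = 0 \<or> n mod 9 = 6"
  using admissible_odd_frequent_pairs[OF assms]
proof
  assume "frequent n g (-4) \<and> frequent n g 5"
  moreover have "{i \<in> {1..n}. - g i = - v} = {i \<in> {1..n}. g i = v}" for v by auto
  from this[of "-4"] this[of 5]
  have "frequent n (\<lambda>i. - g i) 4 = frequent n g (-4)" "frequent n (\<lambda>i. - g i) (-5) = frequent n g 5"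
    by simp_all
  ultimately show ?thesis
    using admissible_frequent_4_5_mod_9[OF admissible_labelling_uminus[OF g]] by blast
qed (use admissible_frequent_4_5_mod_9[OF g] in blast)

text \<open>For odd \<open>n\<close> one of 5 and -5 is frequent, and three copies of it reach 15 in
  absolute value, above the bound 12.\<close>

lemma not_admissible_4_odd:
  assumes n: "n > 63" and odd: "odd n"
  shows "\<not> admissible_labelling n 4 g"
proof
  assume g: "admissible_labelling n 4 g"
  have "frequent n g (-5) \<or> frequent n g 5"
    using admissible_odd_frequent_pairs[OF admissible_labelling_mono[OF g] n odd] by auto
  then show False
    using admissible_frequent_triple(1)[OF g, of "-5" "-5" "-5"]
      admissible_frequent_triple(1)[OF g, of 5 5 5] by auto
qed

text \<open>The bound 6 restricts frequent labels to absolute value at most 2. Congruence modulo 3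
  leaves (-2, 1) and (-1, 2), and both yield a triple with sum 0.\<close>

lemma not_admissible_2:
  assumes n: "n > 63"
  shows "\<not> admissible_labelling n 2 g"
proof
  assume g: "admissible_labelling n 2 g"
  then have g5: "admissible_labelling n 5 g" by (rule admissible_labelling_mono) simp
  obtain v where v: "v < 0" "frequent n g v"
    using admissible_frequent_negative[OF g5 n] by blast
  obtain w where w: "w > 0" "frequent n g w"
    using admissible_frequent_positive[OF g5 n] by blast
  have "v \<in> {-2, -1}" "w \<in> {1, 2}"
    using admissible_frequent_triple(1)[OF g v(2) v(2) v(2)]
      admissible_frequent_triple(1)[OF g w(2) w(2) w(2)] v w by auto
  then show False
    using admissible_frequent_triple(1)[OF g v(2) v(2) w(2)]
      admissible_frequent_triple(1)[OF g v(2) w(2) w(2)]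
      admissible_frequent_triple(2)[OF g w(2) v(2) v(2)] by auto
qed

section \<open>Upper bounds: explicit labellings with at most three values\<close>

lemma admissible_labelling_three_values:
  fixes x y z :: int
  assumes "p < n" "x + int p * y + int (n - 1 - p) * z = 0" "3 dvd x - z" "3 dvd y - z"
    and "\<And>t. t \<in> {x + 2 * y, x + y + z, x + 2 * z, 3 * y, 2 * y + z, y + 2 * z, 3 * z} \<Longrightarrow>
           t \<noteq> 0 \<and> \<bar>t\<bar> \<le> 3 * int N"
  shows "admissible_labelling n N (\<lambda>i. if i = 1 then x else if i \<le> Suc p then y else z)"
    (is "admissible_labelling n N ?g")
  unfolding admissible_labelling_def
proof (intro conjI ballI impI)
  have "{1..n} = insert 1 ({2..Suc p} \<union> {Suc (Suc p)..n})" using assms(1) by auto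
  then have "(\<Sum>i\<in>{1..n}. ?g i) = ?g 1 + ((\<Sum>i\<in>{2..Suc p}. ?g i) + (\<Sum>i\<in>{Suc (Suc p)..n}. ?g i))"
    by (simp only:) (subst sum.insert; simp add: sum.union_disjoint)
  also have "(\<Sum>i\<in>{2..Suc p}. ?g i) = (\<Sum>i\<in>{2..Suc p}. y)" by (intro sum.cong) auto
  also have "(\<Sum>i\<in>{Suc (Suc p)..n}. ?g i) = (\<Sum>i\<in>{Suc (Suc p)..n}. z)" by (intro sum.cong) auto
  finally show "(\<Sum>i\<in>{1..n}. ?g i) = 0" using assms(1,2) by (simp add: algebra_simps)
next
  fix i j
  have "3 dvd ?g k - z" for k using assms(3,4) by simp
  from dvd_diff[OF this[of i] this[of j]] show "3 dvd ?g i - ?g j" by simp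
next
  fix a b c :: nat assume "distinct [a, b, c]"
  \<comment> \<open>The label x sits at a single point, so it enters a triple at most once and seven
    types of sums remain.\<close>
  then have "?g a + ?g b + ?g c \<in> {x + 2 * y, x + y + z, x + 2 * z, 3 * y, 2 * y + z, y + 2 * z, 3 * z}"
    by (cases "a = 1"; cases "b = 1"; cases "c = 1"; cases "a \<le> Suc p"; cases "b \<le> Suc p"; cases "c \<le> Suc p")
       simp_all
  from assms(5)[OF this] show "?g a + ?g b + ?g c \<noteq> 0" "\<bar>?g a + ?g b + ?g c\<bar> \<le> 3 * int N"
    by blast+
qed

text \<open>Half of the points get 3 and half get -3; triple sums are 3 or 9 in absolute
  value.\<close>

lemma admissible_3_even:
  assumes "even n" "n > 0" shows "\<exists>g. admissible_labelling n 3 g"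
proof -
  obtain m where "n = 2 * m" using assms(1) by (rule evenE)
  then show ?thesis using assms(2)
    by - (rule exI, rule admissible_labelling_three_values[of "m - 1" n 3 3 "-3"], auto simp: of_nat_diff)
qed

text \<open>One label 12 balances four more labels -3 than labels 3. The largest triple sum is 12 +
  3 + 3 = 18.\<close>

lemma admissible_6_odd:
  assumes "odd n" "n \<ge> 5" shows "\<exists>g. admissible_labelling n 6 g"
proof -
  obtain m where "n = 2 * m + 1" using assms(1) by (rule oddE)
  then show ?thesis using assms(2)
    by - (rule exI, rule admissible_labelling_three_values[of "m - 2" n 12 3 "-3"], auto simp: of_nat_diff)
qed

text \<open>The labels 4 and -5 in proportion 5 to 4 balance when 9 divides \<open>n\<close>. For
  residue 6, one label -2 goes with 5k + 3 labels 4 and 4k + 2 labels -5.\<close>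

lemma admissible_5_mod_9:
  assumes "n mod 9 = 0 \<or> n mod 9 = 6" "n > 0" shows "\<exists>g. admissible_labelling n 5 g"
  using assms(1)
proof
  assume "n mod 9 = 0"
  then obtain k where "n = 9 * k" by auto
  then show ?thesis using assms(2)
    by - (rule exI, rule admissible_labelling_three_values[of "5 * k - 1" n 4 4 "-5"], auto simp: of_nat_diff)
next
  assume "n mod 9 = 6"
  then obtain k where "n = 9 * k + 6" by (metis div_mult_mod_eq mult.commute)
  then show ?thesis
    by - (rule exI, rule admissible_labelling_three_values[of "5 * k + 3" n "-2" 4 "-5"], auto simp: of_nat_diff)
qed

section \<open>Nowhere-zero integer eigenvectors and labellings\<close>

text \<open>The weights \<open>f\<close> need not be integral, but their differences are: two
  vertices sharing two points differ by one. Hence 3 f is integral and constant modulo 3, and it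
  serves as the labelling.\<close>

lemma johnson_eigenvector_imp_admissible:
  assumes nzi: "nowhere_zero_integer (johnson_graph n 3) u"
    and ev: "eigenvector_of (johnson_graph n 3) (2 * real n - 9) u" and n: "n \<ge> 4"
    and bound: "\<And>S. S \<in> pverts (johnson_graph n 3) \<Longrightarrow> \<bar>u S\<bar> \<le> real N"
  shows "\<exists>g. admissible_labelling n N g"
proof -
  obtain f where f0: "(\<Sum>i\<in>{1..n}. f i) = 0"
    and f: "\<And>a b c. \<lbrakk>a \<in> {1..n}; b \<in> {1..n}; c \<in> {1..n}; distinct [a, b, c]\<rbrakk> \<Longrightarrow> u {a, b, c} = f a + f b + f c"
    using johnson_eigenvector_imp_sum[OF ev n] by metis
  have f_int: "f a + f b + f c \<in> \<int>" and f_nz: "f a + f b + f c \<noteq> 0"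
    and f_bound: "\<bar>f a + f b + f c\<bar> \<le> real N"
    if abc: "a \<in> {1..n}" "b \<in> {1..n}" "c \<in> {1..n}" "distinct [a, b, c]" for a b c
  proof -
    have "{a, b, c} \<in> pverts (johnson_graph n 3)" using abc unfolding johnson_pverts_iff by blast
    with nzi bound[OF this] show "f a + f b + f c \<in> \<int>" "f a + f b + f c \<noteq> 0"
      "\<bar>f a + f b + f c\<bar> \<le> real N"
      unfolding nowhere_zero_integer_def f[OF abc, symmetric] by blast+
  qed
  have other: "\<exists>c\<in>{1..n}. c \<notin> A" if "finite A" "card A < n" for A
  proof (rule ccontr)
    assume "\<not> ?thesis"
    then have "card {1..n} \<le> card A" using that(1) by (intro card_mono) auto
    with that(2) show False by simp
  qed
  have card3: "card {a, b, c} < n" for a b c :: nat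
    using n by (simp add: card_insert_if)
  have diff_int: "f a - f b \<in> \<int>" if ab: "a \<in> {1..n}" "b \<in> {1..n}" for a b
  proof -
    obtain c where c: "c \<in> {1..n}" "c \<notin> {a, b, b}" using other[OF _ card3] by blast
    obtain d where d: "d \<in> {1..n}" "d \<notin> {a, b, c}" using other[OF _ card3] by blast
    have "f a + f c + f d \<in> \<int>" "f b + f c + f d \<in> \<int>" using f_int ab c d by auto
    from Ints_diff[OF this] show ?thesis by simp
  qed
  \<comment> \<open>Write 3 f a as (f a + f c + f d) + (f a - f c) + (f a - f d).\<close>
  have "3 * f a \<in> \<int>" if a: "a \<in> {1..n}" for a
  proof -
    obtain c where c: "c \<in> {1..n}" "c \<notin> {a, a, a}" using other[OF _ card3] by blast
    obtain d where d: "d \<in> {1..n}" "d \<notin> {a, a, c}" using other[OF _ card3] by blast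
    have "f a + f c + f d \<in> \<int>" using f_int a c d by auto
    from Ints_add[OF Ints_add[OF this diff_int[OF a c(1)]] diff_int[OF a d(1)]]
    show ?thesis by simp
  qed
  then have "\<forall>a\<in>{1..n}. \<exists>k. 3 * f a = of_int k" by (metis Ints_cases)
  then obtain g where g: "\<And>a. a \<in> {1..n} \<Longrightarrow> 3 * f a = of_int (g a)" by metis
  have "admissible_labelling n N g"
    unfolding admissible_labelling_def
  proof (intro conjI ballI impI)
    have "real_of_int (\<Sum>i\<in>{1..n}. g i) = (\<Sum>i\<in>{1..n}. 3 * f i)" by (simp add: g)
    also have "\<dots> = 0" using f0 by (simp flip: sum_distrib_left)
    finally show "(\<Sum>i\<in>{1..n}. g i) = 0" by (simp only: of_int_eq_0_iff)
  next
    fix i j assume ij: "i \<in> {1..n}" "j \<in> {1..n}"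
    obtain k where "f i - f j = of_int k" using diff_int[OF ij] by (rule Ints_cases)
    then have "real_of_int (g i - g j) = of_int (3 * k)" using g[OF ij(1)] g[OF ij(2)] by simp
    then show "3 dvd g i - g j" by (simp only: of_int_eq_iff) simp
  next
    fix a b c assume abc: "a \<in> {1..n}" "b \<in> {1..n}" "c \<in> {1..n}" "distinct [a, b, c]"
    have *: "real_of_int (g a + g b + g c) = 3 * (f a + f b + f c)"
      using g[OF abc(1)] g[OF abc(2)] g[OF abc(3)] by simp
    show "g a + g b + g c \<noteq> 0" using f_nz[OF abc] * by force
    have "real_of_int \<bar>g a + g b + g c\<bar> \<le> real_of_int (3 * int N)"
      unfolding of_int_abs * using f_bound[OF abc] by (simp add: abs_mult)
    then show "\<bar>g a + g b + g c\<bar> \<le> 3 * int N" by (simp only: of_int_le_iff)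
  qed
  then show ?thesis by blast
qed

text \<open>Congruence of the labels modulo 3 makes every triple sum divisible by 3, so dividing by
  3 gives integer entries.\<close>

lemma admissible_imp_johnson_eigenvector:
  assumes g: "admissible_labelling n N g" and n: "n \<ge> 3"
  defines "u \<equiv> \<lambda>S. \<Sum>i\<in>S. real_of_int (g i) / 3"
  shows "nowhere_zero_integer (johnson_graph n 3) u"
    and "eigenvector_of (johnson_graph n 3) (2 * real n - 9) u"
    and "\<And>S. S \<in> pverts (johnson_graph n 3) \<Longrightarrow> \<bar>u S\<bar> \<le> real N"
proof -
  have *: "u S \<in> \<int> \<and> u S \<noteq> 0 \<and> \<bar>u S\<bar> \<le> real N" if S_in: "S \<in> pverts (johnson_graph n 3)" for S
  proof -
    obtain a b c where abc: "a \<in> {1..n}" "b \<in> {1..n}" "c \<in> {1..n}" "distinct [a, b, c]"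
      and S: "S = {a, b, c}"
      using S_in unfolding johnson_pverts_iff by blast
    have "g a + g b + g c = 3 * g a - (g a - g b) - (g a - g c)" by simp
    also have "3 dvd \<dots>"
      by (intro dvd_diff admissible_labellingD(2)[OF g] abc) simp
    finally obtain k where k: "g a + g b + g c = 3 * k" by (rule dvdE)
    have "u S = real_of_int (g a + g b + g c) / 3"
      using abc unfolding u_def S by (simp add: add_divide_distrib)
    then have "u S = of_int k" unfolding k by simp
    moreover have "k \<noteq> 0" "\<bar>k\<bar> \<le> int N"
      using admissible_labellingD(3)[OF g abc] unfolding k by auto
    moreover have "real_of_int \<bar>k\<bar> \<le> real_of_int (int N)"
      using \<open>\<bar>k\<bar> \<le> int N\<close> by (simp only: of_int_le_iff)
    ultimately show ?thesis by simp
  qed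
  then show "nowhere_zero_integer (johnson_graph n 3) u"
    "\<And>S. S \<in> pverts (johnson_graph n 3) \<Longrightarrow> \<bar>u S\<bar> \<le> real N"
    unfolding nowhere_zero_integer_def by blast+
  have "{1, 2, 3} \<in> pverts (johnson_graph n 3)" using n by (simp add: johnson_graph_def)
  moreover from *[OF this] have "u {1, 2, 3} \<noteq> 0" by blast
  moreover have "(\<Sum>i\<in>{1..n}. real_of_int (g i) / 3) = 0"
    using admissible_labellingD(1)[OF g] by (simp flip: sum_divide_distrib of_int_sum)
  ultimately show "eigenvector_of (johnson_graph n 3) (2 * real n - 9) u"
    unfolding u_def by (intro johnson_eigenvector_sum)
qed

text \<open>The sup norm of an integer vector is a natural number M, and the vector yields a
  labelling with bound M, so N is a lower bound. A labelling with bound \<open>N\<close> yields a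
  vector of norm at most \<open>N\<close>, so the minimum is attained.\<close>

lemma m_nzi_1_johnson_eqI:
  assumes n: "n \<ge> 4" and ex: "\<exists>g. admissible_labelling n N g"
    and least: "\<And>g M. M < N \<Longrightarrow> \<not> admissible_labelling n M g"
  shows "m_nzi 1 (johnson_graph n 3) = real N + 1"
proof -
  let ?J = "johnson_graph n 3"
  have fin: "finite (pverts ?J)" by (simp add: johnson_graph_def)
  have "{1, 2, 3} \<in> pverts ?J" using n by (simp add: johnson_graph_def)
  then have ne: "pverts ?J \<noteq> {}" by blast
  have lower: "real N \<le> sup_norm ?J u"
    if nzi: "nowhere_zero_integer ?J u" and ev: "eigenvector_of ?J (2 * real n - 9) u" for u
  proof -
    have "sup_norm ?J u \<in> (\<lambda>x. \<bar>u x\<bar>) ` pverts ?J"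
      unfolding sup_norm_def using fin ne by (intro Max_in) auto
    then obtain S where S: "S \<in> pverts ?J" "sup_norm ?J u = \<bar>u S\<bar>" by blast
    with nzi have "u S \<in> \<int>" by (simp add: nowhere_zero_integer_def)
    then obtain k where "u S = of_int k" by (rule Ints_cases)
    with S have M: "sup_norm ?J u = real (nat \<bar>k\<bar>)" by simp
    have "\<bar>u S\<bar> \<le> real (nat \<bar>k\<bar>)" if "S \<in> pverts ?J" for S
      unfolding M[symmetric] sup_norm_def using fin that by (intro Max_ge) auto
    from johnson_eigenvector_imp_admissible[OF nzi ev n this] least have "N \<le> nat \<bar>k\<bar>"
      by (meson not_less)
    then show ?thesis unfolding M by simp
  qed
  obtain g where g: "admissible_labelling n N g" using ex by blast
  have "n \<ge> 3" using n by simp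
  define u where "u = (\<lambda>S. \<Sum>i\<in>S. real_of_int (g i) / 3)"
  note u = admissible_imp_johnson_eigenvector[OF g \<open>n \<ge> 3\<close>, folded u_def]
  have "sup_norm ?J u \<le> real N"
    unfolding sup_norm_def using u(3) fin ne by (subst Max_le_iff) auto
  with lower[OF u(1,2)] have norm_u: "sup_norm ?J u = real N" by simp
  show ?thesis
    unfolding m_nzi_def eigenvalue_nth_1_johnson[OF n]
  proof (rule Least_equality)
    show "\<exists>u. nowhere_zero_integer ?J u \<and> eigenvector_of ?J (2 * real n - 9) u \<and> real N + 1 = sup_norm ?J u + 1"
      using u(1,2) norm_u by auto
  next
    fix q assume "\<exists>u. nowhere_zero_integer ?J u \<and> eigenvector_of ?J (2 * real n - 9) u \<and> q = sup_norm ?J u + 1"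
    then show "real N + 1 \<le> q" using lower by auto
  qed
qed

theorem theorem5:
  fixes n :: nat
  assumes "n > 63"
  shows "m_nzi 1 (johnson_graph n 3) =
    (if even n then 4
     else if [n = 0] (mod 9) \<or> [n = 6] (mod 9) then 6
     else 7)"
proof -
  have mod9: "[n = 0] (mod 9) \<or> [n = 6] (mod 9) \<longleftrightarrow> n mod 9 = 0 \<or> n mod 9 = 6"
    by (simp add: cong_def)
  have "n \<ge> 4" using assms by simp
  note eqI = m_nzi_1_johnson_eqI[OF this]
  consider "even n" | "odd n" "n mod 9 = 0 \<or> n mod 9 = 6" | "odd n" "\<not> (n mod 9 = 0 \<or> n mod 9 = 6)"
    by blast
  then show ?thesis
  proof cases
    case 1
    \<comment> \<open>Admissibility is monotone in the bound, so it suffices to exclude the largest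
      bound below the claimed one, here and in the other two cases.\<close>
    have "\<not> admissible_labelling n M g" if "M < 3" for M g
      using not_admissible_2[OF assms] admissible_labelling_mono[of n M g 2] that by auto
    from eqI[OF admissible_3_even this] 1 assms show ?thesis by simp
  next
    case 2
    have "\<not> admissible_labelling n M g" if "M < 5" for M g
      using not_admissible_4_odd[OF assms 2(1)] admissible_labelling_mono[of n M g 4] that by auto
    from eqI[OF admissible_5_mod_9[OF 2(2)] this] 2 assms show ?thesis unfolding mod9 by simp
  next
    case 3
    have "\<not> admissible_labelling n M g" if "M < 6" for M g
      using admissible_odd_mod_9[OF _ assms 3(1)] 3(2) admissible_labelling_mono[of n M g 5] that by auto
    from eqI[OF admissible_6_odd[OF 3(1)] this] 3 assms show ?thesis unfolding mod9 by simp
  qed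
qed

end
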